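(* Let $\lambda,\mu\in\mathbb{R}$, let $f:\mathbb{R}\to\mathbb{R}$ be given by $f(x)=\lfloor\lambda x+\mu\rfloor$, and let $\mathrm{Fix}(f)=\{x\in\mathbb{R}: f(x)=x\}$. (i) If $\lambda>1$, then $$\mathrm{Fix}(f)=\begin{cases}\left\{\left\lceil-\frac{\mu}{\lambda-1}\right\rceil,\left\lceil-\frac{\mu}{\lambda-1}\right\rceil+1,\ldots,\left\lceil-\frac{\mu-1}{\lambda-1}\right\rceil-1\right\},&\text{if }\left\lceil-\frac{\mu}{\lambda-1}\right\rceil\leqslant\left\lceil-\frac{\mu-1}{\lambda-1}\right\rceil-1;\\ \varnothing,&\text{if }\left\lceil-\frac{\mu}{\lambda-1}\right\rceil>\left\lceil-\frac{\mu-1}{\lambda-1}\right\rceil-1.\end{cases}$$ (ii) If $\lambda=1$, then $$\mathrm{Fix}(f)=\begin{cases}\mathbb{Z},&\text{if }0\leqslant\mu<1;\\ \varnothing,&\text{if }\mu<0\text{ or }\mu\geqslant1.\end{cases}$$ (iii) If $\lambda<1$, then $$\mathrm{Fix}(f)=\begin{cases}\left\{\left\lfloor-\frac{\mu-1}{\lambda-1}\right\rfloor+1,\left\lfloor-\frac{\mu-1}{\lambda-1}\right\rfloor+2,\ldots,\left\lfloor-\frac{\mu}{\lambda-1}\right\rfloor\right\},&\text{if }\left\lfloor-\frac{\mu-1}{\lambda-1}\right\rfloor+1\leqslant\left\lfloor-\frac{\mu}{\lambda-1}\right\rfloor;\\ \varnothing,&\text{if }\left\lfloor-\frac{\mu-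1}{\lambda-1}\right\rfloor+1>\left\lfloor-\frac{\mu}{\lambda-1}\right\rfloor.\end{cases}$$
   Context: $\lfloor\cdot\rfloor$ and $\lceil\cdot\rceil$ denote the floor and ceiling functions. For integers $a\leqslant b$, $\{a,a+1,\ldots,b\}$ denotes the set of all integers $m$ with $a\leqslant m\leqslant b$. *)

theory Defs
  imports Complex_Main
begin

definition Fix :: "(real \<Rightarrow> real) \<Rightarrow> real set"
  where "Fix f = {x. f x = x}"

end

theory Submission
  imports Defs
begin

text \<open>A fixed point is an integer \<open>n\<close> with \<open>0 \<le> (\<lambda> - 1) n + \<mu> < 1\<close>. Dividing by \<open>\<lambda> - 1\<close>,
  with attention to its sign, confines \<open>n\<close> to a half-open real interval whose integer points
  are read off from floors or ceilings of the endpoints.\<close>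

lemma Fix_floor_affine:
  fixes a b :: real
  shows "Fix (\<lambda>x. of_int \<lfloor>a * x + b\<rfloor>) = of_int ` {n. 0 \<le> (a - 1) * of_int n + b \<and> (a - 1) * of_int n + b < 1}"
proof -
  have "\<lfloor>a * of_int n + b\<rfloor> = n \<longleftrightarrow> 0 \<le> (a - 1) * of_int n + b \<and> (a - 1) * of_int n + b < 1" for n
    by (auto simp: floor_eq_iff algebra_simps)
  \<comment> \<open>A fixed point equals a value of the map, hence has the form
    \<open>of_int n\<close>, and injectivity of \<open>of_int\<close> moves the equation from reals
    to integers.\<close>
  moreover have "Fix (\<lambda>x. of_int \<lfloor>a * x + b\<rfloor>) = of_int ` {n. \<lfloor>a * of_int n + b\<rfloor> = n}"
    unfolding Fix_def by (auto simp: image_iff) metis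
  ultimately show ?thesis by simp
qed

text \<open>Division by \<open>a - 1 > 0\<close> keeps the inequalities. The left endpoint is
  attained, so the least candidate is its ceiling; the right one is excluded, and the largest
  integer strictly below a real is its ceiling minus 1.\<close>

lemma Fix_floor_affine_gt_1:
  fixes a b :: real
  assumes "a > 1"
  shows "Fix (\<lambda>x. of_int \<lfloor>a * x + b\<rfloor>) = of_int ` {\<lceil>- (b / (a - 1))\<rceil> .. \<lceil>- ((b - 1) / (a - 1))\<rceil> - 1}"
proof -
  have "0 \<le> (a - 1) * x + b \<longleftrightarrow> - (b / (a - 1)) \<le> x"
    and "(a - 1) * x + b < 1 \<longleftrightarrow> x < - ((b - 1) / (a - 1))" for x
    using assms by (simp_all add: field_simps)
  then show ?thesis
    by (auto simp: Fix_floor_affine ceiling_le_iff less_ceiling_iff zle_diff1_eq intro!: image_cong)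
qed

text \<open>Division by \<open>a - 1 < 0\<close> reverses the inequalities and swaps the endpoints.
  Now the left one is excluded, hence the floor plus 1, and the right one is attained, hence the
  plain floor.\<close>

lemma Fix_floor_affine_lt_1:
  fixes a b :: real
  assumes "a < 1"
  shows "Fix (\<lambda>x. of_int \<lfloor>a * x + b\<rfloor>) = of_int ` {\<lfloor>- ((b - 1) / (a - 1))\<rfloor> + 1 .. \<lfloor>- (b / (a - 1))\<rfloor>}"
proof -
  have "0 \<le> (a - 1) * x + b \<longleftrightarrow> x \<le> - (b / (a - 1))"
    and "(a - 1) * x + b < 1 \<longleftrightarrow> - ((b - 1) / (a - 1)) < x" for x
    using assms by (simp_all add: field_simps)
  then show ?thesis
    by (auto simp: Fix_floor_affine le_floor_iff floor_less_iff add1_zle_eq intro!: image_cong)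
qed

theorem theorem1:
  fixes lam \<mu> :: real and f :: "real \<Rightarrow> real"
  assumes f: "\<And>x. f x = of_int \<lfloor>lam * x + \<mu>\<rfloor>"
  shows "(lam > 1 \<longrightarrow>
            (\<lceil>- (\<mu> / (lam - 1))\<rceil> \<le> \<lceil>- ((\<mu> - 1) / (lam - 1))\<rceil> - 1 \<longrightarrow>
               Fix f = of_int ` {\<lceil>- (\<mu> / (lam - 1))\<rceil> .. \<lceil>- ((\<mu> - 1) / (lam - 1))\<rceil> - 1}) \<and>
            (\<lceil>- (\<mu> / (lam - 1))\<rceil> > \<lceil>- ((\<mu> - 1) / (lam - 1))\<rceil> - 1 \<longrightarrow>
               Fix f = {}))
       \<and> (lam = 1 \<longrightarrow>
            (0 \<le> \<mu> \<and> \<mu> < 1 \<longrightarrow> Fix f = \<int>) \<and>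
            (\<mu> < 0 \<or> \<mu> \<ge> 1 \<longrightarrow> Fix f = {}))
       \<and> (lam < 1 \<longrightarrow>
            (\<lfloor>- ((\<mu> - 1) / (lam - 1))\<rfloor> + 1 \<le> \<lfloor>- (\<mu> / (lam - 1))\<rfloor> \<longrightarrow>
               Fix f = of_int ` {\<lfloor>- ((\<mu> - 1) / (lam - 1))\<rfloor> + 1 .. \<lfloor>- (\<mu> / (lam - 1))\<rfloor>}) \<and>
            (\<lfloor>- ((\<mu> - 1) / (lam - 1))\<rfloor> + 1 > \<lfloor>- (\<mu> / (lam - 1))\<rfloor> \<longrightarrow>
               Fix f = {}))"
proof -
  have f_eq: "f = (\<lambda>x. of_int \<lfloor>lam * x + \<mu>\<rfloor>)"
    using f by blast
  \<comment> \<open>The coefficient \<open>lam - 1\<close> vanishes, so the condition on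
    \<open>n\<close> no longer involves \<open>n\<close>: every integer is fixed, or none
    is.\<close>
  have "Fix f = (if 0 \<le> \<mu> \<and> \<mu> < 1 then \<int> else {})" if "lam = 1"
    using that unfolding f_eq Fix_floor_affine by (auto simp: Ints_def)
  \<comment> \<open>An interval whose lower bound exceeds its upper bound is empty, so each of the
    two lemmas yields both branches of its case.\<close>
  then show ?thesis
    using Fix_floor_affine_gt_1[of lam \<mu>] Fix_floor_affine_lt_1[of lam \<mu>]
    unfolding f_eq[symmetric] by auto
qed

end
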